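(* Let $k\geq 0$ be an integer and let $G$ be a $k$-tree with $n$ vertices. Then $$\operatorname{tw}(G)+\operatorname{tw}(\overline{G})=\begin{cases} n-1 & \text{if } G\cong Q_n^k,\\ n-2 & \text{otherwise,}\end{cases}$$ where $\overline{G}$ denotes the complement of $G$ and $\operatorname{tw}$ denotes treewidth.
   Context: Graphs are finite, simple, undirected and nonempty. The complement $\overline{G}$ has the same vertex set as $G$, and two distinct vertices are adjacent in $\overline{G}$ if and only if they are not adjacent in $G$. For an integer $k\geq 0$, a graph $G$ is a $k$-tree if $G\cong K_{k+1}$ or $G-v$ is a $k$-tree for some vertex $v$ whose neighbours induce a $k$-clique (a clique on exactly $k$ vertices). Treewidth is the usual notion, defined via tree decompositions (minimum over tree decompositions of the maximum bag size minus one); equivalently, $\operatorname{tw}(G)$ is the minimum integer $k$ such that $G$ is a spanning subgraph of a $k$-tree. For $n\geq k+1$, $Q_n^k$ is the $n$-vertex $k$-tree consisting of a $k$-clique $C$ together with $n-k$ further vertices, each of which is adjacent to every vertex of $C$ and to no other vertex. *)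

theory Defs
  imports "Graph_Theory.Graph_Theory"
begin

text \<open>
  Finite simple undirected graphs are the graphs of the locale \<^locale>\<open>graph\<close>: finite symmetric
  digraphs without loops and without parallel arcs, an undirected edge being a pair of opposite
  arcs.
\<close>

definition graph_complement :: "('a, 'b) pre_digraph \<Rightarrow> 'a pair_pre_digraph" where
  "graph_complement G =
    \<lparr> pverts = verts G,
      parcs = {(u, v). u \<in> verts G \<and> v \<in> verts G \<and> u \<noteq> v \<and> (u, v) \<notin> arcs_ends G} \<rparr>"

definition neighbours :: "('a, 'b) pre_digraph \<Rightarrow> 'a \<Rightarrow> 'a set" where
  "neighbours G v = {u. (v, u) \<in> arcs_ends G}"

inductive k_tree :: "nat \<Rightarrow> ('a, 'b) pre_digraph \<Rightarrow> bool" for k :: nat where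
  complete: "complete_digraph (k + 1) G \<Longrightarrow> k_tree k G"
| del_vert: "\<lbrakk> graph G; v \<in> verts G;
      complete_digraph k (G \<restriction> neighbours G v);
      k_tree k (pre_digraph.del_vert G v) \<rbrakk> \<Longrightarrow> k_tree k G"

text \<open>
  In a symmetric digraph every edge yields a closed walk of length two, which the library counts
  as a \<^const>\<open>pre_digraph.cycle\<close>, so that its \<^const>\<open>tree\<close> is unsuitable here. The cycles of the
  underlying undirected simple graph are those of length at least three.
\<close>

definition undirected_tree :: "('a, 'b) pre_digraph \<Rightarrow> bool" where
  "undirected_tree T \<longleftrightarrow>
    graph T \<and> Digraph_Component.connected T \<and>
    \<not> (\<exists>p. pre_digraph.cycle T p \<and> 3 \<le> length p)"

text \<open>
  \<^const>\<open>Digraph_Component.connected\<close> entails that the vertex set is nonempty. Hence the last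
  condition below also says that each vertex of the graph lies in some bag.
\<close>

definition tree_decomposition ::
    "('a, 'b) pre_digraph \<Rightarrow> ('t, 'e) pre_digraph \<Rightarrow> ('t \<Rightarrow> 'a set) \<Rightarrow> bool" where
  "tree_decomposition G T B \<longleftrightarrow>
    undirected_tree T \<and>
    (\<forall>t \<in> verts T. B t \<subseteq> verts G) \<and>
    (\<forall>(u, v) \<in> arcs_ends G. \<exists>t \<in> verts T. u \<in> B t \<and> v \<in> B t) \<and>
    (\<forall>v \<in> verts G. Digraph_Component.connected (T \<restriction> {t \<in> verts T. v \<in> B t}))"

definition decomposition_width :: "('t, 'e) pre_digraph \<Rightarrow> ('t \<Rightarrow> 'a set) \<Rightarrow> nat" where
  "decomposition_width T B = Max ((\<lambda>t. card (B t)) ` verts T) - 1"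

text \<open>
  Natural numbers suffice as nodes, since every finite tree is isomorphic to one on them. The
  truncated subtraction in the width is harmless for nonempty graphs, which have a nonempty bag
  in every tree decomposition.
\<close>

definition treewidth :: "('a, 'b) pre_digraph \<Rightarrow> nat" where
  "treewidth G =
    (LEAST w. \<exists>(T :: nat pair_pre_digraph) B.
      tree_decomposition G (with_proj T) B \<and> w = decomposition_width (with_proj T) B)"

text \<open>
  The clique is \<open>{..<k}\<close>. Intended for \<open>k + 1 \<le> n\<close>, which holds for the order \<open>n\<close> of any
  \<open>k\<close>-tree.
\<close>

definition Q_graph :: "nat \<Rightarrow> nat \<Rightarrow> nat pair_pre_digraph" where
  "Q_graph n k =
    \<lparr> pverts = {..<n},
      parcs = {(i, j). i < n \<and> j < n \<and> i \<noteq> j \<and> (i < k \<or> j < k)} \<rparr>"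

end

theory Submission
  imports Defs
begin

text \<open>
  A \<open>k\<close>-tree \<open>G\<close> has treewidth \<open>k\<close>: its construction order yields bags consisting of a new vertex
  and its \<open>k\<close>-clique of neighbours, and it contains a clique on \<open>k + 1\<close> vertices, which must lie in
  a single bag. So all depends on the treewidth of the complement, for which two bounds are
  combined.

  For the lower bound, every tree decomposition has a bag meeting all members of a given bramble, that is,
  of a family of connected, pairwise touching vertex sets (\<open>bramble_hit_by_bag\<close>, a consequence of
  the Helly property of subtrees of a tree, \<open>subtrees_Helly\<close>). If two edges \<open>ac\<close> and \<open>bd\<close> of the
  complement do not touch, then \<open>a, b, c, d\<close> is an induced 4-cycle of \<open>G\<close>. A \<open>k\<close>-tree has no induced
  4-cycle, so the edges of its complement form a bramble. A bag meeting all of them is a vertex cover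
  of the complement; the vertices outside it form a clique of \<open>G\<close>, hence are at most \<open>k + 1\<close> in
  number. This leaves at least \<open>n - k - 1\<close> vertices in the bag (\<open>treewidth_complement_ge\<close>).

  For the upper bound, a clique \<open>C\<close> of \<open>G\<close> is independent in the complement. So the complement has a
  decomposition along a star, with all vertices outside \<open>C\<close> in the central bag and, for every
  \<open>c \<in> C\<close>, a leaf bag with \<open>c\<close> and its non-neighbours in \<open>G\<close>. If \<open>C\<close> has \<open>k + 1\<close> vertices, each
  of degree at least \<open>k + 1\<close> in \<open>G\<close>, no bag has more than \<open>n - k - 1\<close> vertices and the lower bound is
  attained. By induction, every \<open>k\<close>-tree has such a clique unless it is \<open>Q\<^sub>n\<^sup>k\<close>
  (\<open>k_tree_core_or_high_degree_clique\<close>). For \<open>Q\<^sub>n\<^sup>k\<close> itself, the complement consists of isolated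
  vertices and a clique on \<open>n - k\<close> vertices, so its treewidth is larger by one.
\<close>

section \<open>Connectedness by cuts and acyclicity by degeneracy\<close>

text \<open>
  Connectedness in terms of cuts rather than walks: every proper part of \<open>S\<close> has an edge to the
  rest of \<open>S\<close>. In this form it is easily followed through the addition and removal of leaves and
  through unions of subtrees.
\<close>

definition connected_on :: "('a \<times> 'a) set \<Rightarrow> 'a set \<Rightarrow> bool" where
  "connected_on E S \<longleftrightarrow> S \<noteq> {} \<and>
    (\<forall>A. A \<subseteq> S \<and> A \<noteq> {} \<and> A \<noteq> S \<longrightarrow> (\<exists>x\<in>A. \<exists>y\<in>S - A. (x, y) \<in> E))"

text \<open>
  A finite loopless graph is a forest if and only if each of its nonempty induced subgraphs has a vertex of degree
  at most one. Unlike the absence of cycles, this supplies the leaf for an induction at once and is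
  visibly inherited by subgraphs.
\<close>

definition forest_on :: "('a \<times> 'a) set \<Rightarrow> 'a set \<Rightarrow> bool" where
  "forest_on E V \<longleftrightarrow> (\<forall>S. S \<subseteq> V \<and> S \<noteq> {} \<longrightarrow>
    (\<exists>x\<in>S. \<forall>y\<in>S. \<forall>z\<in>S. (x, y) \<in> E \<and> (x, z) \<in> E \<longrightarrow> y = z))"

lemma connected_onD:
  assumes "connected_on E S" "A \<subseteq> S" "A \<noteq> {}" "A \<noteq> S"
  obtains x y where "x \<in> A" "y \<in> S - A" "(x, y) \<in> E"
  using assms unfolding connected_on_def by blast

lemma forest_onD:
  assumes "forest_on E V" "S \<subseteq> V" "S \<noteq> {}"
  obtains x where "x \<in> S"
    "\<And>y z. y \<in> S \<Longrightarrow> z \<in> S \<Longrightarrow> (x, y) \<in> E \<Longrightarrow> (x, z) \<in> E \<Longrightarrow> y = z"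
proof -
  have "\<exists>x\<in>S. \<forall>y\<in>S. \<forall>z\<in>S. (x, y) \<in> E \<and> (x, z) \<in> E \<longrightarrow> y = z"
    using assms by (simp add: forest_on_def)
  then show thesis using that by blast
qed

lemma connected_on_nonempty: "connected_on E S \<Longrightarrow> S \<noteq> {}"
  by (simp add: connected_on_def)

lemma arcs_ends_induce_subgraph: "arcs_ends (T \<restriction> S) = arcs_ends T \<inter> S \<times> S"
  by (auto simp: arcs_ends_conv)

lemma symcl_eq_if_sym: "sym E \<Longrightarrow> E\<^sup>s = E"
  by (auto simp: symcl_def dest: symD)

lemma connected_iff_connected_on:
  assumes "sym (arcs_ends T)"
  shows "Digraph_Component.connected T \<longleftrightarrow> connected_on (arcs_ends T) (verts T)"
    (is "?L \<longleftrightarrow> ?R")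
proof
  assume L: ?L
  have "\<exists>x\<in>A. \<exists>y\<in>verts T - A. (x, y) \<in> arcs_ends T"
    if A: "A \<subseteq> verts T" "A \<noteq> {}" "A \<noteq> verts T" for A
  proof (rule ccontr)
    assume no_cut: "\<not> ?thesis"
    obtain u v where u: "u \<in> A" and v: "v \<in> verts T" "v \<notin> A" using A by blast
    have "(u, v) \<in> rtrancl_on (verts T) (arcs_ends T)"
      using L A u v assms unfolding connected_conv by (auto simp: symcl_eq_if_sym)
    then have "v \<in> A"
      using u no_cut by (induction rule: rtrancl_on_induct) auto
    with v show False by simp
  qed
  then show ?R using L unfolding connected_on_def connected_conv by blast
next
  assume R: ?R
  have "(u, v) \<in> rtrancl_on (verts T) (arcs_ends T)" if u: "u \<in> verts T" and v: "v \<in> verts T" for u v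
  proof (rule ccontr)
    assume nv: "\<not> ?thesis"
    let ?A = "{w. (u, w) \<in> rtrancl_on (verts T) (arcs_ends T)}"
    have "?A \<subseteq> verts T" by (auto dest: in_rtrancl_on_in_F)
    moreover have "?A \<noteq> {}" using u by blast
    moreover have "?A \<noteq> verts T" using v nv by blast
    ultimately obtain x y where "x \<in> ?A" "y \<in> verts T - ?A" "(x, y) \<in> arcs_ends T"
      by (rule connected_onD[OF R])
    then show False by (auto intro: rtrancl_on_into_rtrancl_on)
  qed
  then show ?L
    using R assms unfolding connected_conv by (auto simp: symcl_eq_if_sym connected_on_def)
qed

lemma connected_induced_iff_connected_on:
  assumes "sym (arcs_ends T)"
  shows "Digraph_Component.connected (T \<restriction> S) \<longleftrightarrow> connected_on (arcs_ends T) S"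
proof -
  have "sym (arcs_ends (T \<restriction> S))"
    using assms by (auto simp: arcs_ends_induce_subgraph sym_def)
  moreover have "connected_on (arcs_ends T \<inter> S \<times> S) S \<longleftrightarrow> connected_on (arcs_ends T) S"
    unfolding connected_on_def by (intro conj_cong all_cong1 imp_cong refl) blast
  ultimately show ?thesis
    by (simp add: connected_iff_connected_on arcs_ends_induce_subgraph)
qed

text \<open>
  If all degrees in the subgraph induced by \<open>S\<close> are at least two, consider a longest path in it. The
  first vertex of the path has a neighbour other than its successor. That neighbour cannot extend the
  path, so it lies further down and closes a cycle of length at least three.
\<close>

lemma forest_on_if_no_long_cycle:
  assumes "graph T" and no_cycle: "\<not> (\<exists>p. pre_digraph.cycle T p \<and> 3 \<le> length p)"
  shows "forest_on (arcs_ends T) (verts T)"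
proof (rule ccontr)
  interpret T: graph T by fact
  assume "\<not> ?thesis"
  then obtain S where S: "S \<subseteq> verts T" "S \<noteq> {}"
    and no_leaf: "\<not> (\<exists>x\<in>S. \<forall>y\<in>S. \<forall>z\<in>S.
      (x, y) \<in> arcs_ends T \<and> (x, z) \<in> arcs_ends T \<longrightarrow> y = z)"
    unfolding forest_on_def not_all not_imp by (elim exE conjE) (rule that)
  have two: "\<exists>y\<in>S. \<exists>z\<in>S. (x, y) \<in> arcs_ends T \<and> (x, z) \<in> arcs_ends T \<and> y \<noteq> z"
    if "x \<in> S" for x
    using no_leaf that by simp
  have sub: "induced_subgraph (T \<restriction> S) T" using S by blast
  interpret H: digraph "T \<restriction> S" using sub by (rule T.digraphI_induced)
  interpret H: graph "T \<restriction> S"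
    using induced_graph_imp_symmetric[OF T.sym_arcs sub] by blast
  define P where "P n \<longleftrightarrow> (\<exists>u p v. H.apath u p v \<and> length p = n)" for n
  obtain s where "s \<in> S" using S by blast
  then have "P 0" unfolding P_def using H.apath_Nil_iff by (intro exI[of _ s] exI[of _ "[]"]) simp
  moreover have bound: "n < Suc (card S)" if "P n" for n
    using that H.length_apath_less unfolding P_def by force
  ultimately have "P (Greatest P)" and max: "\<And>n. P n \<Longrightarrow> n \<le> Greatest P"
    by (auto intro: GreatestI_nat Greatest_le_nat less_imp_le)
  then obtain u p v where p: "H.apath u p v" and len: "length p = Greatest P"
    unfolding P_def by blast
  have u: "u \<in> S" using p by (auto simp: H.apath_def)
  obtain w where w: "w \<in> S" "(u, w) \<in> arcs_ends T" "p \<noteq> [] \<Longrightarrow> w \<noteq> head T (hd p)"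
    using two[OF u] by metis
  then have "(w, u) \<in> arcs_ends (T \<restriction> S)"
    using u by (auto simp: arcs_ends_induce_subgraph intro: T.graph_symmetric)
  then obtain e where e: "e \<in> arcs (T \<restriction> S)" "tail (T \<restriction> S) e = w" "head (T \<restriction> S) e = u"
    by (rule reachableE)
  show False
  proof (cases "w \<in> set (H.awalk_verts u p)")
    case False
    then have "H.apath w (e # p) v" using e p by (auto simp: H.apath_Cons_iff)
    then have "P (Suc (length p))" unfolding P_def by (metis length_Cons)
    then show False using max len by fastforce
  next
    case True
    moreover have "H.awalk u p v" using p by (simp add: H.apath_def)
    ultimately obtain q r where qr: "p = q @ r" "H.awalk u q w" "H.awalk w r v"
      using H.awalk_decomp by blast
    \<comment> \<open>The part of the path up to \<open>w\<close>, closed by the arc from \<open>w\<close> to \<open>u\<close>, is the cycle.\<close>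
    have "distinct (H.awalk_verts u q)"
      using p qr H.apath_append_iff[of u q r v] by (simp add: H.apath_def)
    then have "H.cycle (e # q)"
      using e qr(2) w(1) unfolding H.cycle_def
      by (intro exI[of _ w]) (auto simp: H.awalk_Cons_iff)
    then have "T.cycle (e # q)"
      using T.subgraph_cycle induced_imp_subgraph[OF sub] by blast
    moreover have "3 \<le> length (e # q)"
    proof (rule ccontr)
      assume "\<not> ?thesis"
      then consider "q = []" | a where "q = [a]" by (cases q; cases "tl q") auto
      then show False
      proof cases
        case 1
        then show ?thesis using qr(2) w(2) T.adj_not_same by (auto simp: H.awalk_Nil_iff)
      next
        case 2
        then show ?thesis using qr w(3) by (auto simp: H.awalk_simps)
      qed
    qed
    ultimately show False using no_cycle by blast
  qed
qed

lemma (in pre_digraph) cas_nth_Suc: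
  "cas u p v \<Longrightarrow> Suc i < length p \<Longrightarrow> tail G (p ! Suc i) = head G (p ! i)"
proof (induction p arbitrary: u i)
  case (Cons e p)
  then show ?case by (cases i; cases p) auto
qed simp

text \<open>
  On a cycle of length at least three the predecessor and the successor of a vertex are distinct, so
  the vertex set of the cycle induces a subgraph with all degrees at least two.
\<close>

lemma no_long_cycle_if_forest_on:
  assumes "graph T" and forest: "forest_on (arcs_ends T) (verts T)"
  shows "\<not> (\<exists>p. pre_digraph.cycle T p \<and> 3 \<le> length p)"
proof
  interpret T: graph T by fact
  assume "\<exists>p. T.cycle p \<and> 3 \<le> length p"
  then obtain p u where walk: "T.awalk u p u" and dist: "distinct (tl (T.awalk_verts u p))"
    and len: "3 \<le> length p"
    unfolding T.cycle_def by blast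
  have ne: "p \<noteq> []" using len by auto
  have cas: "T.cas u p u" and arcs: "set p \<subseteq> arcs T" using walk by (auto simp: T.awalk_def)
  have "T.awalk_verts u p = tail T (hd p) # map (head T) p"
    using T.awalk_verts_conv'[OF cas] ne by simp
  then have inj: "distinct (map (head T) p)" using dist by simp
  let ?n = "length p"
  let ?S = "head T ` set p"
  define nxt where "nxt i = (if Suc i = ?n then 0 else Suc i)" for i
  have step: "tail T (p ! nxt i) = head T (p ! i)" if "i < ?n" for i
  proof (cases "Suc i = ?n")
    case False
    then show ?thesis using T.cas_nth_Suc[OF cas] that by (simp add: nxt_def)
  next
    case True
    have "tail T (p ! 0) = u" using cas ne by (cases p) auto
    moreover have "head T (last p) = u"
      using T.awlast_if_cas[OF cas] ne by (simp add: T.awalk_verts_conv)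
    moreover have "last p = p ! i" using True ne by (simp add: last_conv_nth flip: True)
    ultimately show ?thesis using True by (simp add: nxt_def)
  qed
  have "?S \<subseteq> verts T" "?S \<noteq> {}" using arcs ne by auto
  then obtain x where x: "x \<in> ?S"
    and one: "\<And>y z. y \<in> ?S \<Longrightarrow> z \<in> ?S \<Longrightarrow> (x, y) \<in> arcs_ends T \<Longrightarrow> (x, z) \<in> arcs_ends T \<Longrightarrow> y = z"
    using forest_onD[OF forest] by metis
  obtain i where i: "i < ?n" "x = head T (p ! i)" using x by (auto simp: in_set_conv_nth)
  define a where "a = nxt i"
  define b where "b = (if i = 0 then ?n - 1 else i - 1)"
  have ab: "a < ?n" "b < ?n" "a \<noteq> b" and nxt_b: "nxt b = i"
    using i(1) len by (auto simp: a_def b_def nxt_def)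
  have "(x, head T (p ! a)) \<in> arcs_ends T"
    using T.in_arcs_imp_in_arcs_ends[of "p ! a"] arcs ab step[OF i(1)] i(2)
    by (simp add: nth_mem subsetD flip: a_def)
  moreover have "(head T (p ! b), x) \<in> arcs_ends T"
    using T.in_arcs_imp_in_arcs_ends[of "p ! i"] arcs i step[OF ab(2)] nxt_b
    by (simp add: nth_mem subsetD)
  then have "(x, head T (p ! b)) \<in> arcs_ends T" by (rule T.graph_symmetric)
  ultimately have "head T (p ! a) = head T (p ! b)"
    by (intro one) (use ab in auto)
  then show False using inj ab by (simp add: distinct_conv_nth)
qed

text \<open>
  From here on trees are only handled through the two conditions on the right.
\<close>

lemma undirected_tree_iff:
  "undirected_tree T \<longleftrightarrow>
    graph T \<and> connected_on (arcs_ends T) (verts T) \<and> forest_on (arcs_ends T) (verts T)"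
proof (cases "graph T")
  case True
  then interpret T: graph T .
  have "sym (arcs_ends T)" using T.sym_arcs by (simp add: symmetric_def)
  then show ?thesis
    unfolding undirected_tree_def
    using forest_on_if_no_long_cycle[OF True] no_long_cycle_if_forest_on[OF True]
      connected_iff_connected_on by blast
qed (simp add: undirected_tree_def)

section \<open>The Helly property of subtrees\<close>

text \<open>
  Removing a leaf \<open>x\<close> with neighbour \<open>p\<close> destroys no cut edge: a cut of the smaller set becomes a cut
  of \<open>S\<close> when \<open>x\<close> is put on the side of \<open>p\<close>, and then it is not crossed by the edge at \<open>x\<close>.
\<close>

lemma connected_on_delete_leaf:
  assumes "sym E" "connected_on E S" "S \<noteq> {x}"
    and leaf: "\<And>y z. y \<in> S \<Longrightarrow> z \<in> S \<Longrightarrow> (x, y) \<in> E \<Longrightarrow> (x, z) \<in> E \<Longrightarrow> y = z"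
  shows "connected_on E (S - {x})"
proof (cases "x \<in> S")
  case True
  obtain p where p: "p \<in> S" "p \<noteq> x" "(x, p) \<in> E"
    using connected_onD[OF assms(2), of "{x}"] True assms(3) by blast
  have "\<exists>a\<in>A. \<exists>b\<in>S - {x} - A. (a, b) \<in> E"
    if A: "A \<subseteq> S - {x}" "A \<noteq> {}" "A \<noteq> S - {x}" for A
  proof (cases "p \<in> A")
    case True
    obtain a b where "a \<in> insert x A" "b \<in> S - insert x A" "(a, b) \<in> E"
      by (rule connected_onD[OF assms(2), of "insert x A"]) (use A \<open>x \<in> S\<close> in auto)
    then show ?thesis using leaf p True by blast
  next
    case False
    obtain a b where "a \<in> A" "b \<in> S - A" "(a, b) \<in> E"
      by (rule connected_onD[OF assms(2), of A]) (use A \<open>x \<in> S\<close> in auto)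
    then show ?thesis using leaf p False A symD[OF assms(1)] by blast
  qed
  then show ?thesis using p unfolding connected_on_def by blast
qed (use assms in simp)

text \<open>
  Induction on the number of nodes, by removing a leaf \<open>x\<close>. If \<open>{x}\<close> is one of the subtrees, all of
  them contain \<open>x\<close>. Otherwise every subtree through \<open>x\<close> also contains the only neighbour of \<open>x\<close>, so
  the subtrees still meet pairwise once \<open>x\<close> is removed.
\<close>

lemma subtrees_Helly:
  assumes "finite V" "sym E" "forest_on E V" "V \<noteq> {}"
    and "\<And>S. S \<in> F \<Longrightarrow> S \<subseteq> V \<and> connected_on E S"
    and "\<And>S S'. S \<in> F \<Longrightarrow> S' \<in> F \<Longrightarrow> S \<inter> S' \<noteq> {}"
  shows "\<exists>x\<in>V. \<forall>S\<in>F. x \<in> S"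
  using assms
proof (induction "card V" arbitrary: V F rule: less_induct)
  case less
  show ?case
  proof (cases "F = {}")
    case True
    then show ?thesis using less.prems by blast
  next
    case ne: False
    obtain x where x: "x \<in> V"
      and leaf: "\<And>y z. y \<in> V \<Longrightarrow> z \<in> V \<Longrightarrow> (x, y) \<in> E \<Longrightarrow> (x, z) \<in> E \<Longrightarrow> y = z"
      using forest_onD[OF less.prems(3) order_refl less.prems(4)] by metis
    show ?thesis
    proof (cases "{x} \<in> F")
      case True
      then have "\<forall>S\<in>F. x \<in> S" using less.prems(6) by fastforce
      then show ?thesis using x by blast
    next
      case False
      have conn: "connected_on E (S - {x})" "S - {x} \<subseteq> V - {x}" if "S \<in> F" for S
        using less.prems(5)[OF that] leaf less.prems(2) False that
        by (auto intro!: connected_on_delete_leaf)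
      have meet: "(S - {x}) \<inter> (S' - {x}) \<noteq> {}" if SS': "S \<in> F" "S' \<in> F" for S S'
      proof (cases "x \<in> S \<and> x \<in> S'")
        case True
        have "\<exists>y\<in>R. y \<noteq> x \<and> (x, y) \<in> E" if "R \<in> F" "x \<in> R" for R
          using connected_onD[of E R "{x}"] less.prems(5)[OF that(1)] that False by blast
        then obtain y z where "y \<in> S" "y \<noteq> x" "(x, y) \<in> E" "z \<in> S'" "(x, z) \<in> E"
          using True SS' by meson
        then show ?thesis using leaf less.prems(5) SS' by blast
      next
        case False
        then show ?thesis using less.prems(6)[OF SS'] by blast
      qed
      have "\<exists>y\<in>V - {x}. \<forall>S\<in>(\<lambda>S. S - {x}) ` F. y \<in> S"
      proof (rule less.hyps)
        show "card (V - {x}) < card V" using x less.prems(1) by (rule card_Diff1_less[rotated])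
        show "forest_on E (V - {x})" using less.prems(3) unfolding forest_on_def by blast
        obtain S where "S \<in> F" using ne by blast
        then show "V - {x} \<noteq> {}" using connected_on_nonempty[OF conn(1)] conn(2) by fastforce
        show "finite (V - {x})" "sym E" using less.prems by auto
        show "S \<subseteq> V - {x} \<and> connected_on E S" if "S \<in> (\<lambda>S. S - {x}) ` F" for S
          using that conn by blast
        show "S \<inter> S' \<noteq> {}" if "S \<in> (\<lambda>S. S - {x}) ` F" "S' \<in> (\<lambda>S. S - {x}) ` F" for S S'
          using that meet by blast
      qed
      then show ?thesis by simp blast
    qed
  qed
qed

section \<open>Tree decompositions\<close>

lemma tree_decomposition_iff:
  "tree_decomposition G T B \<longleftrightarrow>
    graph T \<and> connected_on (arcs_ends T) (verts T) \<and> forest_on (arcs_ends T) (verts T) \<and>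
    (\<forall>t\<in>verts T. B t \<subseteq> verts G) \<and>
    (\<forall>(u, v)\<in>arcs_ends G. \<exists>t\<in>verts T. u \<in> B t \<and> v \<in> B t) \<and>
    (\<forall>v\<in>verts G. connected_on (arcs_ends T) {t \<in> verts T. v \<in> B t})"
proof (cases "graph T")
  case True
  then interpret T: graph T .
  have "sym (arcs_ends T)" using T.sym_arcs by (simp add: symmetric_def)
  then show ?thesis
    unfolding tree_decomposition_def undirected_tree_iff
    by (simp add: connected_induced_iff_connected_on)
qed (simp add: tree_decomposition_def undirected_tree_def)

text \<open>
  The easy direction of the duality between brambles and treewidth. The nodes whose bags meet a
  connected set \<open>X\<close> form a subtree \<open>N X\<close>, being a union of the subtrees of the vertices of \<open>X\<close>, where
  adjacent vertices have intersecting subtrees. Touching sets have intersecting subtrees, and the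
  Helly property provides a common node.
\<close>

lemma bramble_hit_by_bag:
  assumes td: "tree_decomposition G T B"
    and conn: "\<And>X. X \<in> \<B> \<Longrightarrow> X \<subseteq> verts G \<and> connected_on (arcs_ends G) X"
    and touch: "\<And>X Y. X \<in> \<B> \<Longrightarrow> Y \<in> \<B> \<Longrightarrow>
      X \<inter> Y \<noteq> {} \<or> (\<exists>x\<in>X. \<exists>y\<in>Y. (x, y) \<in> arcs_ends G)"
  obtains t where "t \<in> verts T" "\<And>X. X \<in> \<B> \<Longrightarrow> X \<inter> B t \<noteq> {}"
proof -
  interpret T: graph T using td by (simp add: tree_decomposition_iff)
  define N where "N X = {t \<in> verts T. X \<inter> B t \<noteq> {}}" for X
  have sym: "sym (arcs_ends T)" using T.sym_arcs by (simp add: symmetric_def)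
  have vertex: "connected_on (arcs_ends T) {t \<in> verts T. v \<in> B t}" if "v \<in> verts G" for v
    using td that by (simp add: tree_decomposition_iff)
  have edge: "\<exists>t\<in>verts T. u \<in> B t \<and> v \<in> B t" if "(u, v) \<in> arcs_ends G" for u v
    using td that by (auto simp: tree_decomposition_iff)
  have N_conn: "connected_on (arcs_ends T) (N X)" if "X \<in> \<B>" for X
    unfolding connected_on_def
  proof (intro conjI allI impI)
    have X: "X \<subseteq> verts G" "connected_on (arcs_ends G) X" using conn[OF that] by auto
    then obtain v where "v \<in> X" "v \<in> verts G" using connected_on_nonempty by blast
    then show "N X \<noteq> {}" using connected_on_nonempty[OF vertex[of v]] unfolding N_def by blast
    fix A assume A: "A \<subseteq> N X \<and> A \<noteq> {} \<and> A \<noteq> N X"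
    show "\<exists>x\<in>A. \<exists>y\<in>N X - A. (x, y) \<in> arcs_ends T"
    proof (rule ccontr)
      assume no_cut: "\<not> ?thesis"
      \<comment> \<open>No edge leaves \<open>A\<close>, so each subtree of a vertex of \<open>X\<close> lies inside \<open>A\<close> or misses it.\<close>
      have side: "{t \<in> verts T. v \<in> B t} \<subseteq> A" (is "?S \<subseteq> A")
        if "v \<in> X" "s \<in> A" "v \<in> B s" for v s
      proof (rule ccontr)
        assume "\<not> ?thesis"
        moreover have "s \<in> verts T" using A that by (auto simp: N_def)
        ultimately have "?S \<inter> A \<noteq> {}" "?S \<inter> A \<noteq> ?S" using that by auto
        moreover have "connected_on (arcs_ends T) ?S" using vertex that X by blast
        ultimately obtain x y where "x \<in> ?S \<inter> A" "y \<in> ?S - ?S \<inter> A" "(x, y) \<in> arcs_ends T"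
          using connected_onD[of _ ?S "?S \<inter> A"] by blast
        then show False using no_cut that by (auto simp: N_def)
      qed
      \<comment> \<open>The vertices with subtrees inside \<open>A\<close> are a proper part of \<open>X\<close>;
        an edge leaving this part joins vertices with disjoint subtrees.\<close>
      let ?C = "{v \<in> X. \<exists>s\<in>A. v \<in> B s}"
      have "?C \<noteq> {}" using A by (auto simp: N_def)
      moreover have "?C \<noteq> X"
      proof -
        obtain t where "t \<in> N X" "t \<notin> A" using A by blast
        then show ?thesis using side unfolding N_def by blast
      qed
      ultimately obtain u v where "u \<in> ?C" "v \<in> X - ?C" "(u, v) \<in> arcs_ends G"
        using connected_onD[OF X(2), of ?C] by blast
      then show False using edge side by blast
    qed
  qed
  have "\<exists>t\<in>verts T. \<forall>S\<in>N ` \<B>. t \<in> S"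
  proof (rule subtrees_Helly[OF T.finite_verts sym])
    show "forest_on (arcs_ends T) (verts T)" using td by (simp add: tree_decomposition_iff)
    show "verts T \<noteq> {}" using td by (simp add: tree_decomposition_iff connected_on_def)
    show "S \<subseteq> verts T \<and> connected_on (arcs_ends T) S" if "S \<in> N ` \<B>" for S
      using that N_conn by (auto simp: N_def)
    show "S \<inter> S' \<noteq> {}" if SS': "S \<in> N ` \<B>" "S' \<in> N ` \<B>" for S S'
    proof -
      obtain X Y where XY: "X \<in> \<B>" "Y \<in> \<B>" "S = N X" "S' = N Y" using SS' by blast
      from touch[OF XY(1,2)] show ?thesis
      proof
        assume "X \<inter> Y \<noteq> {}"
        then obtain v where "v \<in> X" "v \<in> Y" "v \<in> verts G" using conn XY by blast
        then show ?thesis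
          using connected_on_nonempty[OF vertex[of v]] unfolding XY N_def by blast
      next
        assume "\<exists>x\<in>X. \<exists>y\<in>Y. (x, y) \<in> arcs_ends G"
        then show ?thesis using edge unfolding XY N_def by blast
      qed
    qed
  qed
  then show ?thesis using that by (auto simp: N_def)
qed

text \<open>
  The singletons of the vertices of a clique form a bramble.
\<close>

lemma clique_in_bag:
  assumes "tree_decomposition G T B" "K \<subseteq> verts G"
    and "\<And>u v. u \<in> K \<Longrightarrow> v \<in> K \<Longrightarrow> u \<noteq> v \<Longrightarrow> (u, v) \<in> arcs_ends G"
  obtains t where "t \<in> verts T" "K \<subseteq> B t"
proof (rule bramble_hit_by_bag[OF assms(1), of "(\<lambda>v. {v}) ` K"])
  show "X \<subseteq> verts G \<and> connected_on (arcs_ends G) X" if "X \<in> (\<lambda>v. {v}) ` K" for X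
    using that assms(2) by (auto simp: connected_on_def)
  show "X \<inter> Y \<noteq> {} \<or> (\<exists>x\<in>X. \<exists>y\<in>Y. (x, y) \<in> arcs_ends G)"
    if "X \<in> (\<lambda>v. {v}) ` K" "Y \<in> (\<lambda>v. {v}) ` K" for X Y
    using that assms(3) by auto
  fix t assume t: "t \<in> verts T" "\<And>X. X \<in> (\<lambda>v. {v}) ` K \<Longrightarrow> X \<inter> B t \<noteq> {}"
  have "v \<in> B t" if "v \<in> K" for v using t(2)[of "{v}"] that by simp
  then have "K \<subseteq> B t" by blast
  with t(1) show thesis by (rule that)
qed

lemma one_bag_decomposition:
  assumes "wf_digraph G"
  obtains T :: "nat pair_pre_digraph" and B and t where
    "tree_decomposition G (with_proj T) B" "pverts T = {t}" "B t = verts G"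
proof -
  interpret wf_digraph G by fact
  let ?T = "\<lparr>pverts = {0 :: nat}, parcs = {}\<rparr>"
  interpret T: pair_graph ?T by unfold_locales (auto simp: symmetric_def sym_def)
  have conn: "connected_on {} {0 :: nat}" by (auto simp: connected_on_def)
  have "tree_decomposition G (with_proj ?T) (\<lambda>_. verts G)"
    unfolding tree_decomposition_iff
  proof (intro conjI)
    show "graph (with_proj ?T)" by (rule T.pair_graphD_graph)
    show "forest_on (arcs_ends (with_proj ?T)) (verts (with_proj ?T))"
      by (auto simp: forest_on_def)
  qed (use conn adj_in_verts in \<open>auto simp: Collect_conv_if\<close>)
  then show ?thesis by (rule that) simp_all
qed

text \<open>
  The one step by which larger decompositions are built: a bag \<open>X\<close> covering everything new is hung as
  a leaf on a node \<open>t\<close> whose bag contains all old vertices of \<open>X\<close>.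
\<close>

lemma attach_bag:
  fixes T :: "nat pair_pre_digraph"
  assumes td: "tree_decomposition G (with_proj T) B" and t: "t \<in> pverts T"
    and verts: "verts H = verts G \<union> X"
    and arcs: "arcs_ends H \<subseteq> arcs_ends G \<union> X \<times> X"
    and old: "X \<inter> verts G \<subseteq> B t"
  obtains T' :: "nat pair_pre_digraph" and B' and t' where
    "tree_decomposition H (with_proj T') B'" "pverts T' = insert t' (pverts T)"
    "B' t' = X" "\<forall>s\<in>pverts T. B' s = B s"
proof -
  interpret T: pair_graph T
    using td by (intro pair_graphI_graph) (simp add: tree_decomposition_iff)
  have conn: "connected_on (parcs T) (pverts T)" and forest: "forest_on (parcs T) (pverts T)"
    and bags: "\<And>s. s \<in> pverts T \<Longrightarrow> B s \<subseteq> verts G"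
    and edges: "\<And>u v. (u, v) \<in> arcs_ends G \<Longrightarrow> \<exists>s\<in>pverts T. u \<in> B s \<and> v \<in> B s"
    and subtrees: "\<And>v. v \<in> verts G \<Longrightarrow> connected_on (parcs T) {s \<in> pverts T. v \<in> B s}"
    using td by (auto simp: tree_decomposition_iff)
  obtain t' where t': "t' \<notin> pverts T" using T.pair_finite_verts ex_new_if_finite by blast
  have old_arcs: "parcs T \<subseteq> pverts T \<times> pverts T" using T.wellformed' by auto
  define E where "E = parcs T \<union> {(t, t'), (t', t)}"
  let ?T = "\<lparr>pverts = insert t' (pverts T), parcs = E\<rparr>"
  let ?B = "B(t' := X)"
  interpret T': pair_graph ?T
  proof unfold_locales
    show "symmetric (with_proj ?T)"
      using T.arcs_symmetric by (auto simp: symmetric_def sym_def E_def)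
  qed (use T.pair_finite_verts T.pair_finite_arcs old_arcs t t' T.no_loops' in \<open>auto simp: E_def\<close>)
  have connected_old: "connected_on E S" if "connected_on (parcs T) S" for S
    using that unfolding connected_on_def E_def by blast
  have connected_new: "connected_on E (insert t' S)" if S: "connected_on (parcs T) S" "t \<in> S" for S
    unfolding connected_on_def
  proof (intro conjI allI impI)
    fix A assume A: "A \<subseteq> insert t' S \<and> A \<noteq> {} \<and> A \<noteq> insert t' S"
    show "\<exists>x\<in>A. \<exists>y\<in>insert t' S - A. (x, y) \<in> E"
    proof (cases "A - {t'} = {} \<or> A - {t'} = S")
      case True
      then show ?thesis using A S(2) t t' by (auto simp: E_def)
    next
      case False
      then obtain x y where "x \<in> A - {t'}" "y \<in> S - (A - {t'})" "(x, y) \<in> parcs T"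
        using connected_onD[OF S(1), of "A - {t'}"] A by blast
      then show ?thesis using old_arcs t' by (auto simp: E_def)
    qed
  qed simp
  have forest': "forest_on E (insert t' (pverts T))"
    unfolding forest_on_def
  proof (intro allI impI)
    fix S assume S: "S \<subseteq> insert t' (pverts T) \<and> S \<noteq> {}"
    show "\<exists>x\<in>S. \<forall>y\<in>S. \<forall>z\<in>S. (x, y) \<in> E \<and> (x, z) \<in> E \<longrightarrow> y = z"
    proof (cases "t' \<in> S")
      case True
      have "\<forall>y. (t', y) \<in> E \<longrightarrow> y = t" using old_arcs t' by (auto simp: E_def)
      then show ?thesis using True by blast
    next
      case False
      then have "S \<subseteq> pverts T" using S by blast
      then obtain x where "x \<in> S"
        "\<And>y z. y \<in> S \<Longrightarrow> z \<in> S \<Longrightarrow> (x, y) \<in> parcs T \<Longrightarrow> (x, z) \<in> parcs T \<Longrightarrow> y = z"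
        using forest_onD[OF forest] S by metis
      then show ?thesis using False by (auto simp: E_def intro!: bexI[of _ x])
    qed
  qed
  have "tree_decomposition H (with_proj ?T) ?B"
    unfolding tree_decomposition_iff
  proof (intro conjI)
    show "graph (with_proj ?T)" by (rule T'.pair_graphD_graph)
    show "connected_on (arcs_ends (with_proj ?T)) (verts (with_proj ?T))"
      using connected_new[OF conn t] by simp
    show "forest_on (arcs_ends (with_proj ?T)) (verts (with_proj ?T))"
      using forest' by simp
    show "\<forall>s\<in>verts (with_proj ?T). ?B s \<subseteq> verts H"
      using bags verts t' by auto
    show "\<forall>(u, v)\<in>arcs_ends H. \<exists>s\<in>verts (with_proj ?T). u \<in> ?B s \<and> v \<in> ?B s"
    proof clarify
      fix u v assume "(u, v) \<in> arcs_ends H"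
      then consider "(u, v) \<in> arcs_ends G" | "u \<in> X" "v \<in> X" using arcs by blast
      then show "\<exists>s\<in>verts (with_proj ?T). u \<in> ?B s \<and> v \<in> ?B s"
      proof cases
        case 1
        then obtain s where "s \<in> pverts T" "u \<in> B s" "v \<in> B s" using edges by blast
        then show ?thesis using t' by (intro bexI[of _ s]) auto
      qed auto
    qed
    show "\<forall>v\<in>verts H. connected_on (arcs_ends (with_proj ?T)) {s \<in> verts (with_proj ?T). v \<in> ?B s}"
    proof
      fix v assume v: "v \<in> verts H"
      let ?S = "{s \<in> pverts T. v \<in> B s}"
      have S': "{s \<in> verts (with_proj ?T). v \<in> ?B s} = (if v \<in> X then insert t' ?S else ?S)"
        using t' by auto
      show "connected_on (arcs_ends (with_proj ?T)) {s \<in> verts (with_proj ?T). v \<in> ?B s}"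
      proof (cases "v \<in> verts G")
        case True
        then show ?thesis
          using connected_old[OF subtrees] connected_new[OF subtrees] old t unfolding S' by auto
      next
        case False
        then have "?S = {}" "v \<in> X" using bags v verts by auto
        then show ?thesis unfolding S' by (auto simp: connected_on_def)
      qed
    qed
  qed
  then show ?thesis by (rule that) (use t' in auto)
qed

section \<open>Bounds on treewidth\<close>

text \<open>
  Bounding bag sizes by \<open>m\<close> means width at most \<open>m - 1\<close>; the form without the subtraction is the one
  that composes.
\<close>

definition decomposable :: "('a, 'b) pre_digraph \<Rightarrow> nat \<Rightarrow> bool" where
  "decomposable G m \<longleftrightarrow> (\<exists>(T :: nat pair_pre_digraph) B.
    tree_decomposition G (with_proj T) B \<and> (\<forall>t\<in>pverts T. card (B t) \<le> m))"

lemma tree_decomposition_verts: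
  assumes "tree_decomposition G T B"
  shows "finite (verts T)" "verts T \<noteq> {}"
proof -
  interpret T: graph T using assms by (simp add: tree_decomposition_iff)
  show "finite (verts T)" by simp
  show "verts T \<noteq> {}" using assms by (simp add: tree_decomposition_iff connected_on_def)
qed

lemma treewidth_le:
  assumes "decomposable G m"
  shows "treewidth G \<le> m - 1"
proof -
  obtain T :: "nat pair_pre_digraph" and B
    where td: "tree_decomposition G (with_proj T) B" "\<forall>t\<in>pverts T. card (B t) \<le> m"
    using assms unfolding decomposable_def by blast
  have "treewidth G \<le> decomposition_width (with_proj T) B"
    unfolding treewidth_def using td(1) by (intro Least_le) blast
  also have "\<dots> \<le> m - 1"
    using td tree_decomposition_verts[OF td(1)] unfolding decomposition_width_def
    by (intro diff_le_mono Max.boundedI) auto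
  finally show ?thesis .
qed

text \<open>
  The treewidth is the width of an actual decomposition, since the one with a single bag makes the
  set of widths nonempty.
\<close>

lemma treewidth_ge:
  assumes "wf_digraph G"
    and large: "\<And>(T :: nat pair_pre_digraph) B.
      tree_decomposition G (with_proj T) B \<Longrightarrow> \<exists>t\<in>pverts T. m \<le> card (B t)"
  shows "m - 1 \<le> treewidth G"
proof -
  let ?P = "\<lambda>w. \<exists>(T :: nat pair_pre_digraph) B.
      tree_decomposition G (with_proj T) B \<and> w = decomposition_width (with_proj T) B"
  have "\<exists>w. ?P w" using one_bag_decomposition[OF assms(1)] by metis
  then have "?P (treewidth G)" unfolding treewidth_def by (rule LeastI_ex)
  then obtain T :: "nat pair_pre_digraph" and B
    where td: "tree_decomposition G (with_proj T) B"
      and w: "treewidth G = decomposition_width (with_proj T) B"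
    by blast
  obtain t where t: "t \<in> pverts T" "m \<le> card (B t)" using large[OF td] by blast
  have "card (B t) \<le> Max ((\<lambda>t. card (B t)) ` pverts T)"
    using tree_decomposition_verts[OF td] t by (intro Max_ge) auto
  then show ?thesis using t w by (simp add: decomposition_width_def)
qed

text \<open>
  The bags of the vertices of an independent set \<open>I\<close> are hung one after the other on the central bag
  \<open>verts G - I\<close>, which contains all neighbours of \<open>I\<close>.
\<close>

lemma decomposable_star:
  fixes G :: "('a, 'b) pre_digraph"
  assumes "graph G" and I: "I \<subseteq> verts G"
    and indep: "\<And>u v. u \<in> I \<Longrightarrow> v \<in> I \<Longrightarrow> (u, v) \<notin> arcs_ends G"
    and centre: "card (verts G - I) \<le> m"
    and leaves: "\<And>c. c \<in> I \<Longrightarrow> card (insert c (neighbours G c)) \<le> m"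
  shows "decomposable G m"
proof -
  interpret graph G by fact
  let ?C = "verts G - I"
  have fin: "finite I" using I finite_verts finite_subset by blast
  \<comment> \<open>The centre has to be kept as a bag of its own, because the next leaf is attached to it.\<close>
  have partial: "\<exists>(T :: nat pair_pre_digraph) B. tree_decomposition (G \<restriction> (?C \<union> J)) (with_proj T) B \<and>
      (\<forall>t\<in>pverts T. card (B t) \<le> m) \<and> (\<exists>t\<in>pverts T. B t = ?C)"
    if "finite J" "J \<subseteq> I" for J
    using that
  proof (induction J rule: finite_induct)
    case empty
    obtain T :: "nat pair_pre_digraph" and B and t where
      "tree_decomposition (G \<restriction> ?C) (with_proj T) B" "pverts T = {t}" "B t = ?C"
      using one_bag_decomposition[OF wellformed_induce_subgraph[of ?C]] by auto
    then show ?case using centre by (intro exI[of _ T] exI[of _ B]) simp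
  next
    case (insert c J)
    then obtain T :: "nat pair_pre_digraph" and B t
      where td: "tree_decomposition (G \<restriction> (?C \<union> J)) (with_proj T) B"
        and small: "\<forall>t\<in>pverts T. card (B t) \<le> m" and t: "t \<in> pverts T" "B t = ?C"
      by blast
    let ?X = "insert c (neighbours G c)"
    have X: "neighbours G c \<subseteq> ?C"
      using indep insert.prems adj_in_verts by (auto simp: neighbours_def)
    have "verts (G \<restriction> (?C \<union> insert c J)) = verts (G \<restriction> (?C \<union> J)) \<union> ?X" using X by auto
    moreover have "arcs_ends (G \<restriction> (?C \<union> insert c J)) \<subseteq> arcs_ends (G \<restriction> (?C \<union> J)) \<union> ?X \<times> ?X"
      using graph_symmetric by (auto simp: arcs_ends_induce_subgraph neighbours_def)
    moreover have "?X \<inter> verts (G \<restriction> (?C \<union> J)) \<subseteq> B t"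
      using X t insert.hyps insert.prems by auto
    ultimately obtain T' :: "nat pair_pre_digraph" and B' t' where
      "tree_decomposition (G \<restriction> (?C \<union> insert c J)) (with_proj T') B'"
      "pverts T' = insert t' (pverts T)" "B' t' = ?X" "\<forall>s\<in>pverts T. B' s = B s"
      by (rule attach_bag[OF td t(1)])
    moreover have "card ?X \<le> m" using leaves insert.prems by auto
    ultimately show ?case
      using small t by (intro exI[of _ T'] exI[of _ B']) auto
  qed
  have "?C \<union> I = verts G" using I by blast
  moreover have "tree_decomposition (G \<restriction> verts G) T B = tree_decomposition G T B"
    for T :: "(nat, nat \<times> nat) pre_digraph" and B
  proof -
    have "arcs_ends G \<inter> verts G \<times> verts G = arcs_ends G" using adj_in_verts by auto
    then show ?thesis by (simp add: tree_decomposition_def arcs_ends_induce_subgraph)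
  qed
  ultimately show ?thesis
    using partial[OF fin order_refl] unfolding decomposable_def by auto
qed

section \<open>The structure of k-trees\<close>

text \<open>
  The graphs isomorphic to \<open>Q\<^sub>n\<^sup>k\<close>, described on their own vertex set; \<open>K\<close> is the image of the
  \<open>k\<close>-clique.
\<close>

definition core_graph :: "nat \<Rightarrow> ('a, 'b) pre_digraph \<Rightarrow> bool" where
  "core_graph k G \<longleftrightarrow> (\<exists>K. K \<subseteq> verts G \<and> card K = k \<and>
    arcs_ends G = {(u, v). u \<in> verts G \<and> v \<in> verts G \<and> u \<noteq> v \<and> (u \<in> K \<or> v \<in> K)})"

lemma neighbours_subset:
  assumes "graph G"
  shows "neighbours G v \<subseteq> verts G - {v}" "finite (neighbours G v)"
proof -
  interpret graph G by fact
  show "neighbours G v \<subseteq> verts G - {v}"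
    using adj_in_verts adj_not_same by (auto simp: neighbours_def)
  then show "finite (neighbours G v)" by (rule finite_subset) simp
qed

lemma arcs_ends_del_vert:
  "arcs_ends (pre_digraph.del_vert G v) = {(x, y). (x, y) \<in> arcs_ends G \<and> x \<noteq> v \<and> y \<noteq> v}"
  by (auto simp: arcs_ends_conv pre_digraph.del_vert_simps)

lemma complete_neighboursD:
  assumes "complete_digraph k (G \<restriction> neighbours G v)"
  shows "card (neighbours G v) = k"
    "x \<in> neighbours G v \<Longrightarrow> y \<in> neighbours G v \<Longrightarrow> x \<noteq> y \<Longrightarrow> (x, y) \<in> arcs_ends G"
  using assms by (auto simp: complete_digraph_def arcs_ends_induce_subgraph set_eq_iff)

lemma k_tree_graph: "k_tree k G \<Longrightarrow> graph G"
  by (induction rule: k_tree.induct) (simp_all add: complete_digraph_def)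

lemma k_tree_clique:
  assumes "k_tree k G"
  shows "\<exists>K. K \<subseteq> verts G \<and> card K = k + 1 \<and>
    (\<forall>u\<in>K. \<forall>v\<in>K. u \<noteq> v \<longrightarrow> (u, v) \<in> arcs_ends G)"
  using assms
proof (induction rule: k_tree.induct)
  case (complete G)
  then show ?case by (intro exI[of _ "verts G"]) (simp add: complete_digraph_def)
next
  case (del_vert G v)
  then obtain K where "K \<subseteq> verts G - {v}" "card K = k + 1"
    "\<forall>u\<in>K. \<forall>w\<in>K. u \<noteq> w \<longrightarrow> (u, w) \<in> arcs_ends (pre_digraph.del_vert G v)"
    by (auto simp: pre_digraph.del_vert_simps)
  then show ?case by (intro exI[of _ K]) (auto simp: arcs_ends_del_vert)
qed

lemma k_tree_card:
  assumes "k_tree k G"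
  shows "k + 1 \<le> card (verts G)"
proof -
  interpret graph G using assms by (rule k_tree_graph)
  obtain K where "K \<subseteq> verts G" "card K = k + 1" using k_tree_clique[OF assms] by blast
  then show ?thesis using card_mono[OF finite_verts] by metis
qed

text \<open>
  A last vertex \<open>v\<close> of the construction has a clique as neighbourhood, so if \<open>v\<close> lies on the 4-cycle,
  its two neighbours there are adjacent.
\<close>

lemma k_tree_no_induced_C4:
  assumes "k_tree k G" "distinct [a, b, c, d]"
    and "(a, b) \<in> arcs_ends G" "(b, c) \<in> arcs_ends G" "(c, d) \<in> arcs_ends G" "(d, a) \<in> arcs_ends G"
  shows "(a, c) \<in> arcs_ends G \<or> (b, d) \<in> arcs_ends G"
  using assms
proof (induction rule: k_tree.induct)
  case (complete G)
  then interpret graph G by (simp add: complete_digraph_def)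
  have "a \<in> verts G" "c \<in> verts G"
    using complete.prems adj_in_verts[of a b] adj_in_verts[of b c] by blast+
  then show ?case
    using complete by (simp add: complete_digraph_def)
next
  case (del_vert G v)
  interpret graph G by fact
  note nb = complete_neighboursD(2)[OF del_vert.hyps(3), unfolded neighbours_def mem_Collect_eq]
  show ?case
  proof (cases "v \<in> {a, b, c, d}")
    case True
    then show ?thesis
      using nb[of b d] nb[of a c] nb[of c a] nb[of d b] del_vert.prems
        graph_symmetric[of a b] graph_symmetric[of b c] graph_symmetric[of c d] graph_symmetric[of d a]
      by auto
  next
    case False
    then show ?thesis using del_vert.IH del_vert.prems by (auto simp: arcs_ends_del_vert)
  qed
qed

text \<open>
  Induction along the construction. The degrees in a good clique only grow, so the case to consider
  is that of a vertex \<open>v\<close> attached to a clique \<open>N\<close> of \<open>Q\<^sub>n\<^sup>k\<close> with core \<open>K\<close>. If the old graph is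
  complete, any \<open>k\<close> of its vertices can serve as core and \<open>N\<close> is chosen; if \<open>N = K\<close>, the core remains.
  Otherwise \<open>N\<close> contains a vertex \<open>w\<close> outside the core, and \<open>K\<close> together with \<open>w\<close> is a good clique:
  the vertices of \<open>K\<close> are adjacent to all \<open>k + 1\<close> or more others, and \<open>w\<close> to \<open>K\<close> and \<open>v\<close>.
\<close>

lemma k_tree_core_or_high_degree_clique:
  assumes "k_tree k G"
  shows "core_graph k G \<or> (\<exists>C. C \<subseteq> verts G \<and> card C = k + 1 \<and>
    (\<forall>u\<in>C. \<forall>v\<in>C. u \<noteq> v \<longrightarrow> (u, v) \<in> arcs_ends G) \<and>
    (\<forall>c\<in>C. k + 1 \<le> card (neighbours G c)))"
  using assms
proof (induction rule: k_tree.induct)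
  case (complete G)
  then interpret graph G by (simp add: complete_digraph_def)
  have "card (verts G) = Suc k" using complete by (simp add: complete_digraph_def)
  then obtain v K where K: "verts G = insert v K" "v \<notin> K" "card K = k"
    by (metis card_Suc_eq)
  have "arcs_ends G = {(x, y). x \<in> verts G \<and> y \<in> verts G \<and> x \<noteq> y \<and> (x \<in> K \<or> y \<in> K)}"
    using complete K by (auto simp: complete_digraph_def)
  then have "core_graph k G" using K unfolding core_graph_def by blast
  then show ?case ..
next
  case (del_vert G v)
  interpret graph G by fact
  let ?H = "pre_digraph.del_vert G v"
  let ?N = "neighbours G v"
  have vertsH: "verts ?H = verts G - {v}" by (simp add: pre_digraph.del_vert_simps)
  have N: "card ?N = k" "?N \<subseteq> verts G - {v}" "finite ?N"
    using complete_neighboursD(1)[OF del_vert.hyps(3)] neighbours_subset[OF \<open>graph G\<close>] by auto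
  have N_iff: "w \<in> ?N \<longleftrightarrow> (v, w) \<in> arcs_ends G" "w \<in> ?N \<longleftrightarrow> (w, v) \<in> arcs_ends G" for w
    using graph_symmetric by (auto simp: neighbours_def)
  have arcsH: "(x, y) \<in> arcs_ends ?H \<longleftrightarrow> (x, y) \<in> arcs_ends G" if "x \<noteq> v" "y \<noteq> v" for x y
    using that by (auto simp: arcs_ends_del_vert)
  have cardH: "k + 1 \<le> card (verts ?H)" using k_tree_card del_vert.hyps(4) by blast
  from del_vert.IH show ?case
  proof (elim disjE exE conjE)
    fix C assume C: "C \<subseteq> verts ?H" "card C = k + 1"
      "\<forall>u\<in>C. \<forall>w\<in>C. u \<noteq> w \<longrightarrow> (u, w) \<in> arcs_ends ?H"
      "\<forall>c\<in>C. k + 1 \<le> card (neighbours ?H c)"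
    have "card (neighbours ?H c) \<le> card (neighbours G c)" for c
      by (rule card_mono[OF neighbours_subset(2)[OF \<open>graph G\<close>]])
        (auto simp: neighbours_def arcs_ends_del_vert)
    then have "\<forall>c\<in>C. k + 1 \<le> card (neighbours G c)" using C(4) order_trans by blast
    moreover have "C \<subseteq> verts G" using C(1) vertsH by auto
    moreover have "\<forall>u\<in>C. \<forall>w\<in>C. u \<noteq> w \<longrightarrow> (u, w) \<in> arcs_ends G"
      using C(3) by (auto simp: arcs_ends_del_vert)
    ultimately show ?thesis using C(2) by blast
  next
    assume "core_graph k ?H"
    then obtain K where K: "K \<subseteq> verts ?H" "card K = k" and arcsK:
      "arcs_ends ?H = {(x, y). x \<in> verts ?H \<and> y \<in> verts ?H \<and> x \<noteq> y \<and> (x \<in> K \<or> y \<in> K)}"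
      unfolding core_graph_def by blast
    have finK: "finite K" using K(1) vertsH finite_verts by (metis finite_Diff finite_subset)
    have arcsG: "(x, y) \<in> arcs_ends G \<longleftrightarrow> x \<in> verts G \<and> y \<in> verts G \<and> x \<noteq> y \<and> (x \<in> K \<or> y \<in> K)"
      if "x \<noteq> v" "y \<noteq> v" for x y
      using that arcsH[OF that] arcsK vertsH by auto
    consider "card (verts ?H) = k + 1" | "?N = K" | "k + 2 \<le> card (verts ?H)" "?N \<noteq> K"
      using cardH by linarith
    then show ?thesis
    proof cases
      case 1
      have "card (verts ?H - ?N) = 1" "card (verts ?H - K) = 1"
        using 1 N K finK by (simp_all add: card_Diff_subset vertsH)
      then obtain w w' where w: "verts ?H - ?N = {w}" "verts ?H - K = {w'}"
        by (auto simp: card_1_singleton_iff)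
      have "(x, y) \<in> arcs_ends G \<longleftrightarrow> x \<in> verts G \<and> y \<in> verts G \<and> x \<noteq> y \<and> (x \<in> ?N \<or> y \<in> ?N)" for x y
      proof (cases "x = v \<or> y = v")
        case True
        then show ?thesis using N_iff N(2) del_vert.hyps(2) by blast
      next
        case False
        have "z \<in> ?N \<longleftrightarrow> z \<noteq> w" "z \<in> K \<longleftrightarrow> z \<noteq> w'" if "z \<in> verts G" "z \<noteq> v" for z
          using that w vertsH by blast+
        then show ?thesis using False arcsG[of x y] by auto
      qed
      then have "core_graph k G" using N unfolding core_graph_def by (intro exI[of _ ?N]) auto
      then show ?thesis ..
    next
      case 2
      have "(x, y) \<in> arcs_ends G \<longleftrightarrow> x \<in> verts G \<and> y \<in> verts G \<and> x \<noteq> y \<and> (x \<in> K \<or> y \<in> K)" for x y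
      proof (cases "x = v \<or> y = v")
        case True
        then show ?thesis using 2 N_iff N(2) del_vert.hyps(2) by blast
      next
        case False
        then show ?thesis using arcsG by blast
      qed
      then have "core_graph k G" using K vertsH unfolding core_graph_def by (intro exI[of _ K]) auto
      then show ?thesis ..
    next
      case 3
      have "\<not> ?N \<subseteq> K" using 3(2) card_subset_eq[OF finK, of ?N] N(1) K(2) by auto
      then obtain w where w: "w \<in> ?N" "w \<notin> K" by blast
      let ?C = "insert w K"
      have K_v: "u \<in> verts G \<and> u \<noteq> v" if "u \<in> ?C" for u using that K w N vertsH by auto
      have deg: "k + 1 \<le> card (neighbours G c)" if "c \<in> ?C" for c
      proof (cases "c = w")
        case True
        have "insert v K \<subseteq> neighbours G w"
          using N_iff(2)[of w] w arcsG K_v by (auto simp: neighbours_def)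
        then have "card (insert v K) \<le> card (neighbours G w)"
          by (rule card_mono[OF neighbours_subset(2)[OF \<open>graph G\<close>]])
        moreover have "v \<notin> K" using K vertsH by auto
        ultimately show ?thesis using finK K(2) True by simp
      next
        case False
        then have "c \<in> K" using that by simp
        then have "verts ?H - {c} \<subseteq> neighbours G c"
          using arcsG K_v vertsH by (auto simp: neighbours_def)
        then have "card (verts ?H - {c}) \<le> card (neighbours G c)"
          by (rule card_mono[OF neighbours_subset(2)[OF \<open>graph G\<close>]])
        moreover have "card (verts ?H - {c}) = card (verts ?H) - 1"
          using \<open>c \<in> K\<close> K(1) by (intro card_Diff_singleton) auto
        ultimately show ?thesis using 3(1) by simp
      qed
      have "?C \<subseteq> verts G" using K_v by blast
      moreover have "card ?C = k + 1" using finK w K(2) by simp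
      moreover have "\<forall>u\<in>?C. \<forall>x\<in>?C. u \<noteq> x \<longrightarrow> (u, x) \<in> arcs_ends G"
        using arcsG K_v by blast
      ultimately show ?thesis using deg by blast
    qed
  qed
qed

lemma core_graph_if_iso_Q_graph:
  assumes "graph G" "k \<le> n" and iso: "digraph_iso G (with_proj (Q_graph n k))"
  shows "core_graph k G"
proof -
  interpret graph G by fact
  obtain h where h: "digraph_isomorphism h" and Q: "with_proj (Q_graph n k) = app_iso h G"
    using iso unfolding digraph_iso_def by blast
  let ?f = "iso_verts h"
  have inj: "inj_on ?f (verts G)" using h by (simp add: digraph_isomorphism_def)
  have img: "?f ` verts G = {..<n}"
    using arg_cong[OF Q, of verts] by (simp add: Q_graph_def)
  have "parcs (Q_graph n k) = (\<lambda>(u, v). (?f u, ?f v)) ` arcs_ends G"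
    using arg_cong[OF Q, of arcs_ends] arcs_ends_app_iso_eq[OF h] by simp
  then have arcs: "(\<lambda>(u, v). (?f u, ?f v)) ` arcs_ends G =
      {(i, j). i < n \<and> j < n \<and> i \<noteq> j \<and> (i < k \<or> j < k)}"
    by (simp add: Q_graph_def)
  let ?K = "{u \<in> verts G. ?f u < k}"
  have "?f ` ?K = {..<k}"
  proof
    show "{..<k} \<subseteq> ?f ` ?K"
    proof
      fix i assume "i \<in> {..<k}"
      moreover from this have "i \<in> ?f ` verts G" using img assms(2) by simp
      ultimately show "i \<in> ?f ` ?K" by auto
    qed
  qed auto
  moreover have "inj_on ?f ?K" using inj by (rule inj_on_subset) auto
  ultimately have "card ?K = k" using card_image by fastforce
  moreover have "(u, v) \<in> arcs_ends G \<longleftrightarrow>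
    u \<in> verts G \<and> v \<in> verts G \<and> u \<noteq> v \<and> (u \<in> ?K \<or> v \<in> ?K)" for u v
  proof
    assume uv: "(u, v) \<in> arcs_ends G"
    then have "(?f u, ?f v) \<in> (\<lambda>(u, v). (?f u, ?f v)) ` arcs_ends G" by force
    then show "u \<in> verts G \<and> v \<in> verts G \<and> u \<noteq> v \<and> (u \<in> ?K \<or> v \<in> ?K)"
      using uv adj_in_verts[OF uv] unfolding arcs by auto
  next
    assume uv: "u \<in> verts G \<and> v \<in> verts G \<and> u \<noteq> v \<and> (u \<in> ?K \<or> v \<in> ?K)"
    then have "?f u \<noteq> ?f v" using inj by (auto dest: inj_onD)
    moreover have "?f u < n" "?f v < n" using uv img by auto
    ultimately have "(?f u, ?f v) \<in> (\<lambda>(u, v). (?f u, ?f v)) ` arcs_ends G"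
      using uv unfolding arcs by auto
    then obtain u' v' where "(u', v') \<in> arcs_ends G" "?f u' = ?f u" "?f v' = ?f v" by auto
    moreover have "u' = u" "v' = v"
      using inj uv calculation adj_in_verts[OF calculation(1)] by (auto dest: inj_onD)
    ultimately show "(u, v) \<in> arcs_ends G" by simp
  qed
  ultimately show ?thesis unfolding core_graph_def by (intro exI[of _ ?K]) auto
qed

text \<open>
  Any enumeration of the vertices that lists the core first is an isomorphism.
\<close>

lemma iso_Q_graph_if_core_graph:
  assumes "graph G" "core_graph k G"
  shows "digraph_iso G (with_proj (Q_graph (card (verts G)) k))"
proof -
  interpret graph G by fact
  let ?n = "card (verts G)"
  obtain K where K: "K \<subseteq> verts G" "card K = k" and arcsK:
    "arcs_ends G = {(u, v). u \<in> verts G \<and> v \<in> verts G \<and> u \<noteq> v \<and> (u \<in> K \<or> v \<in> K)}"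
    using assms(2) unfolding core_graph_def by blast
  have finK: "finite K" using K(1) finite_verts finite_subset by blast
  have kn: "k \<le> ?n" using card_mono[OF finite_verts K(1)] K(2) by simp
  obtain g where g: "bij_betw g K {..<k}"
    using finite_same_card_bij[OF finK, of "{..<k}"] K(2) by auto
  obtain g' where g': "bij_betw g' (verts G - K) {k..<?n}"
    using finite_same_card_bij[of "verts G - K" "{k..<?n}"] K finK
    by (auto simp: card_Diff_subset)
  define f where "f u = (if u \<in> K then g u else g' u)" for u
  have "bij_betw f K {..<k}" using g by (rule bij_betw_cong[THEN iffD1, rotated]) (simp add: f_def)
  moreover have "bij_betw f (verts G - K) {k..<?n}"
    using g' by (rule bij_betw_cong[THEN iffD1, rotated]) (simp add: f_def)
  ultimately have "bij_betw f (K \<union> (verts G - K)) ({..<k} \<union> {k..<?n})"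
    by (rule bij_betw_combine) auto
  moreover have "K \<union> (verts G - K) = verts G" "{..<k} \<union> {k..<?n} = {..<?n}"
    using K(1) kn by auto
  ultimately have f: "bij_betw f (verts G) {..<?n}" by simp
  have fK: "f u < k \<longleftrightarrow> u \<in> K" if "u \<in> verts G" for u
    using that g g' by (force simp: f_def dest!: bij_betwE)
  have inj: "f u = f v \<longleftrightarrow> u = v" if "u \<in> verts G" "v \<in> verts G" for u v
    using f that by (auto simp: bij_betw_def inj_on_def)
  define h where "h = \<lparr>iso_verts = f, iso_arcs = (\<lambda>e. (f (tail G e), f (head G e))),
    iso_head = snd, iso_tail = fst\<rparr>"
  have h: "digraph_isomorphism h"
    unfolding digraph_isomorphism_def
  proof (intro conjI)
    show "inj_on (iso_verts h) (verts G)" using f by (simp add: h_def bij_betw_def)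
    show "inj_on (iso_arcs h) (arcs G)"
      by (rule inj_onI) (auto simp: h_def inj arc_to_ends_def intro!: no_multi_arcs)
  qed (auto simp: h_def wf_digraph)
  have "arcs (app_iso h G) = (\<lambda>(u, v). (f u, f v)) ` arcs_ends G"
    by (auto simp: h_def arcs_ends_conv image_image)
  also have "\<dots> = parcs (Q_graph ?n k)"
  proof (intro set_eqI iffI)
    fix p assume "p \<in> (\<lambda>(u, v). (f u, f v)) ` arcs_ends G"
    then show "p \<in> parcs (Q_graph ?n k)"
      using bij_betwE[OF f] by (auto simp: arcsK Q_graph_def inj fK)
  next
    fix p assume p: "p \<in> parcs (Q_graph ?n k)"
    then have "fst p \<in> f ` verts G" "snd p \<in> f ` verts G"
      using f by (auto simp: Q_graph_def bij_betw_def)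
    then obtain u v where uv: "u \<in> verts G" "v \<in> verts G" "p = (f u, f v)"
      by (metis imageE prod.collapse)
    then have "(u, v) \<in> arcs_ends G"
      using p by (auto simp: arcsK Q_graph_def fK)
    then show "p \<in> (\<lambda>(u, v). (f u, f v)) ` arcs_ends G" using uv by force
  qed
  finally have "arcs (app_iso h G) = parcs (Q_graph ?n k)" .
  moreover have "verts (app_iso h G) = pverts (Q_graph ?n k)"
    using f by (simp add: h_def Q_graph_def bij_betw_def)
  ultimately have "with_proj (Q_graph ?n k) = app_iso h G"
    by (intro pre_digraph.equality) (simp_all add: h_def)
  then show ?thesis using h unfolding digraph_iso_def by blast
qed

section \<open>Treewidth of a k-tree\<close>

text \<open>
  The neighbourhood of the last vertex is a clique of the remaining graph and so lies in one of its
  bags, to which the new bag can be attached.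
\<close>

lemma k_tree_decomposable:
  assumes "k_tree k G"
  shows "decomposable G (k + 1)"
  using assms
proof (induction rule: k_tree.induct)
  case (complete G)
  then interpret graph G by (simp add: complete_digraph_def)
  obtain T :: "nat pair_pre_digraph" and B and t where
    "tree_decomposition G (with_proj T) B" "pverts T = {t}" "B t = verts G"
    using one_bag_decomposition[OF wf_digraph] by metis
  then show ?case
    using complete unfolding decomposable_def
    by (intro exI[of _ T] exI[of _ B]) (simp add: complete_digraph_def)
next
  case (del_vert G v)
  interpret graph G by fact
  let ?H = "pre_digraph.del_vert G v"
  let ?N = "neighbours G v"
  have N: "?N \<subseteq> verts ?H" "finite ?N"
    using neighbours_subset[OF \<open>graph G\<close>] by (auto simp: pre_digraph.del_vert_simps)
  obtain T :: "nat pair_pre_digraph" and B where td: "tree_decomposition ?H (with_proj T) B"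
    and small: "\<forall>t\<in>pverts T. card (B t) \<le> k + 1"
    using del_vert.IH unfolding decomposable_def by blast
  have "(x, y) \<in> arcs_ends ?H" if "x \<in> ?N" "y \<in> ?N" "x \<noteq> y" for x y
    using complete_neighboursD(2)[OF del_vert.hyps(3) that] that N(1)
    by (auto simp: arcs_ends_del_vert pre_digraph.del_vert_simps)
  then obtain t where t: "t \<in> pverts T" "?N \<subseteq> B t"
    using clique_in_bag[OF td N(1)] by auto
  have "verts G = verts ?H \<union> insert v ?N"
    using del_vert.hyps(2) N(1) by (auto simp: pre_digraph.del_vert_simps)
  moreover have "arcs_ends G \<subseteq> arcs_ends ?H \<union> insert v ?N \<times> insert v ?N"
    using graph_symmetric by (auto simp: arcs_ends_del_vert neighbours_def)
  moreover have "insert v ?N \<inter> verts ?H \<subseteq> B t"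
    using t by (auto simp: pre_digraph.del_vert_simps)
  ultimately obtain T' :: "nat pair_pre_digraph" and B' t' where
    td': "tree_decomposition G (with_proj T') B'" "pverts T' = insert t' (pverts T)"
      "B' t' = insert v ?N" "\<forall>s\<in>pverts T. B' s = B s"
    by (rule attach_bag[OF td t(1)])
  moreover have "card (insert v ?N) \<le> k + 1"
    using card_insert_le_m1[of "k + 1" ?N v] complete_neighboursD(1)[OF del_vert.hyps(3)] by simp
  ultimately show ?case
    using small unfolding decomposable_def by (intro exI[of _ T'] exI[of _ B']) auto
qed

text \<open>
  A clique lies in a bag of the decomposition into bags of at most \<open>k + 1\<close> vertices.
\<close>

lemma k_tree_clique_card_le:
  assumes "k_tree k G" "K \<subseteq> verts G"
    and "\<And>u v. u \<in> K \<Longrightarrow> v \<in> K \<Longrightarrow> u \<noteq> v \<Longrightarrow> (u, v) \<in> arcs_ends G"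
  shows "card K \<le> k + 1"
proof -
  interpret graph G using assms(1) by (rule k_tree_graph)
  obtain T :: "nat pair_pre_digraph" and B where td: "tree_decomposition G (with_proj T) B"
    and small: "\<forall>t\<in>pverts T. card (B t) \<le> k + 1"
    using k_tree_decomposable[OF assms(1)] unfolding decomposable_def by blast
  obtain t where t: "t \<in> pverts T" "K \<subseteq> B t"
    using clique_in_bag[OF td assms(2,3)] by auto
  have "B t \<subseteq> verts G" using td t(1) by (simp add: tree_decomposition_iff)
  then have "card K \<le> card (B t)" by (rule card_mono[OF finite_subset[OF _ finite_verts] t(2)])
  then show ?thesis using small t(1) by force
qed

lemma treewidth_ge_clique:
  assumes "graph G" "K \<subseteq> verts G"
    and clique: "\<And>u v. u \<in> K \<Longrightarrow> v \<in> K \<Longrightarrow> u \<noteq> v \<Longrightarrow> (u, v) \<in> arcs_ends G"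
  shows "card K - 1 \<le> treewidth G"
proof -
  interpret graph G by fact
  show ?thesis
  proof (rule treewidth_ge[OF wf_digraph])
    fix T :: "nat pair_pre_digraph" and B
    assume td: "tree_decomposition G (with_proj T) B"
    obtain t where t: "t \<in> pverts T" "K \<subseteq> B t"
      using clique_in_bag[OF td assms(2) clique] by auto
    have "B t \<subseteq> verts G" using td t(1) by (simp add: tree_decomposition_iff)
    then have "card K \<le> card (B t)" by (rule card_mono[OF finite_subset[OF _ finite_verts] t(2)])
    then show "\<exists>t\<in>pverts T. card K \<le> card (B t)" using t(1) by blast
  qed
qed

lemma treewidth_k_tree:
  assumes "k_tree k G"
  shows "treewidth G = k"
proof -
  obtain K where K: "K \<subseteq> verts G" "card K = k + 1"
    "\<forall>u\<in>K. \<forall>v\<in>K. u \<noteq> v \<longrightarrow> (u, v) \<in> arcs_ends G"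
    using k_tree_clique[OF assms] by blast
  have "k \<le> treewidth G"
    using treewidth_ge_clique[OF k_tree_graph[OF assms] K(1)] K(2,3) by auto
  moreover have "treewidth G \<le> k"
    using treewidth_le[OF k_tree_decomposable[OF assms]] by simp
  ultimately show ?thesis by simp
qed

section \<open>Treewidth of the complement\<close>

lemma graph_complement_simps:
  "pverts (graph_complement G) = verts G"
  "(u, v) \<in> parcs (graph_complement G) \<longleftrightarrow>
    u \<in> verts G \<and> v \<in> verts G \<and> u \<noteq> v \<and> (u, v) \<notin> arcs_ends G"
  by (simp_all add: graph_complement_def)

lemma graph_complement_graph:
  assumes "graph G"
  shows "graph (with_proj (graph_complement G))"
proof -
  interpret graph G by fact
  have "parcs (graph_complement G) \<subseteq> verts G \<times> verts G" by (auto simp: graph_complement_def)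
  then have "finite (parcs (graph_complement G))" by (rule finite_subset) simp
  then interpret C: pair_graph "graph_complement G"
    by unfold_locales
      (auto simp: graph_complement_def symmetric_def sym_def dest: graph_symmetric)
  show ?thesis by (rule C.pair_graphD_graph)
qed

text \<open>
  The edges of the complement, as two-element sets, form a bramble: edges \<open>ac\<close> and \<open>bd\<close> that do not
  touch in the complement give the cycle \<open>a, b, c, d\<close> in \<open>G\<close> without its diagonals. A bag meeting all
  these edges leaves no non-adjacent pair of \<open>G\<close> outside.
\<close>

lemma complement_bag_misses_clique:
  assumes "graph G"
    and chordal4: "\<And>a b c d. distinct [a, b, c, d] \<Longrightarrow> (a, b) \<in> arcs_ends G \<Longrightarrow>
      (b, c) \<in> arcs_ends G \<Longrightarrow> (c, d) \<in> arcs_ends G \<Longrightarrow> (d, a) \<in> arcs_ends G \<Longrightarrow>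
      (a, c) \<in> arcs_ends G \<or> (b, d) \<in> arcs_ends G"
    and td: "tree_decomposition (with_proj (graph_complement G)) T B"
  shows "\<exists>t\<in>verts T. \<forall>u\<in>verts G - B t. \<forall>v\<in>verts G - B t. u \<noteq> v \<longrightarrow> (u, v) \<in> arcs_ends G"
proof -
  interpret graph G by fact
  let ?H = "with_proj (graph_complement G)"
  interpret H: graph ?H using assms(1) by (rule graph_complement_graph)
  obtain t where t: "t \<in> verts T"
    "\<And>X. X \<in> (\<lambda>(u, v). {u, v}) ` arcs_ends ?H \<Longrightarrow> X \<inter> B t \<noteq> {}"
  proof (rule bramble_hit_by_bag[OF td, of "(\<lambda>(u, v). {u, v}) ` arcs_ends ?H"])
    fix X assume "X \<in> (\<lambda>(u, v). {u, v}) ` arcs_ends ?H"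
    then obtain u v where uv: "X = {u, v}" "(u, v) \<in> arcs_ends ?H" by auto
    have vu: "(v, u) \<in> arcs_ends ?H" using H.graph_symmetric uv(2) .
    have "connected_on (arcs_ends ?H) {u, v}"
      unfolding connected_on_def
    proof (intro conjI allI impI)
      fix A assume "A \<subseteq> {u, v} \<and> A \<noteq> {} \<and> A \<noteq> {u, v}"
      then have "A = {u} \<or> A = {v}" "u \<noteq> v" by auto
      then show "\<exists>x\<in>A. \<exists>y\<in>{u, v} - A. (x, y) \<in> arcs_ends ?H" using uv(2) vu by auto
    qed simp
    moreover have "X \<subseteq> verts ?H" using H.adj_in_verts[OF uv(2)] uv(1) by simp
    ultimately show "X \<subseteq> verts ?H \<and> connected_on (arcs_ends ?H) X" using uv(1) by simp
  next
    fix X Y assume "X \<in> (\<lambda>(u, v). {u, v}) ` arcs_ends ?H" "Y \<in> (\<lambda>(u, v). {u, v}) ` arcs_ends ?H"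
    then obtain a c b d where X: "X = {a, c}" "(a, c) \<in> arcs_ends ?H"
      and Y: "Y = {b, d}" "(b, d) \<in> arcs_ends ?H" by auto
    show "X \<inter> Y \<noteq> {} \<or> (\<exists>x\<in>X. \<exists>y\<in>Y. (x, y) \<in> arcs_ends ?H)"
    proof (rule ccontr)
      assume far: "\<not> ?thesis"
      have verts: "X \<subseteq> verts G" "Y \<subseteq> verts G" and ne: "a \<noteq> c" "b \<noteq> d"
        using X Y by (auto simp: graph_complement_simps)
      have disj: "X \<inter> Y = {}" using far by blast
      then have "distinct [a, b, c, d]" using ne X(1) Y(1) by auto
      moreover have "(x, y) \<in> arcs_ends G" if "x \<in> X" "y \<in> Y" for x y
      proof -
        have "(x, y) \<notin> arcs_ends ?H" using far that by blast
        moreover have "x \<noteq> y" using disj that by blast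
        ultimately show ?thesis using that verts by (simp add: graph_complement_simps subset_iff)
      qed
      then have "(a, b) \<in> arcs_ends G" "(c, b) \<in> arcs_ends G" "(c, d) \<in> arcs_ends G" "(a, d) \<in> arcs_ends G"
        using X Y by auto
      ultimately have "(a, c) \<in> arcs_ends G \<or> (b, d) \<in> arcs_ends G"
        using chordal4 graph_symmetric by blast
      then show False using X Y by (simp add: graph_complement_simps)
    qed
  qed blast
  have "(u, v) \<in> arcs_ends G" if "u \<in> verts G - B t" "v \<in> verts G - B t" "u \<noteq> v" for u v
  proof (rule ccontr)
    assume "(u, v) \<notin> arcs_ends G"
    then have "(u, v) \<in> arcs_ends ?H" using that by (simp add: graph_complement_simps)
    then have "{u, v} \<inter> B t \<noteq> {}" using t(2)[of "{u, v}"] by force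
    then show False using that by blast
  qed
  then show ?thesis using t(1) by blast
qed

lemma treewidth_complement_ge:
  assumes "k_tree k G"
  shows "card (verts G) - (k + 1) - 1 \<le> treewidth (with_proj (graph_complement G))"
proof -
  interpret graph G using assms by (rule k_tree_graph)
  let ?H = "with_proj (graph_complement G)"
  interpret H: graph ?H by (rule graph_complement_graph) unfold_locales
  show ?thesis
  proof (rule treewidth_ge[OF H.wf_digraph])
    fix T :: "nat pair_pre_digraph" and B
    assume td: "tree_decomposition ?H (with_proj T) B"
    obtain t where t: "t \<in> pverts T" and clique:
      "\<forall>u\<in>verts G - B t. \<forall>v\<in>verts G - B t. u \<noteq> v \<longrightarrow> (u, v) \<in> arcs_ends G"
      using complement_bag_misses_clique[OF k_tree_graph[OF assms] k_tree_no_induced_C4[OF assms] td]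
      by auto
    have "card (verts G - B t) \<le> k + 1"
      by (rule k_tree_clique_card_le[OF assms]) (use clique in auto)
    moreover have "B t \<subseteq> verts G"
      using td t by (simp add: tree_decomposition_iff graph_complement_simps)
    then have "card (verts G - B t) = card (verts G) - card (B t)"
      by (intro card_Diff_subset finite_subset[OF _ finite_verts])
    ultimately show "\<exists>t\<in>pverts T. card (verts G) - (k + 1) \<le> card (B t)" using t by force
  qed
qed

text \<open>
  The leaf bag of \<open>c \<in> C\<close> in the star decomposition consists of all vertices not adjacent to \<open>c\<close> in
  \<open>G\<close>, including \<open>c\<close> itself; by the degree condition it is no larger than the central bag.
\<close>

lemma treewidth_complement_le:
  assumes "graph G" "C \<subseteq> verts G"
    and clique: "\<And>u v. u \<in> C \<Longrightarrow> v \<in> C \<Longrightarrow> u \<noteq> v \<Longrightarrow> (u, v) \<in> arcs_ends G"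
    and degree: "\<And>c. c \<in> C \<Longrightarrow> card C \<le> card (neighbours G c)"
  shows "treewidth (with_proj (graph_complement G)) \<le> card (verts G) - card C - 1"
proof (rule treewidth_le)
  interpret graph G by fact
  let ?H = "with_proj (graph_complement G)"
  show "decomposable ?H (card (verts G) - card C)"
  proof (rule decomposable_star[OF graph_complement_graph[OF assms(1)], of C])
    show "card (verts ?H - C) \<le> card (verts G) - card C"
      using assms(2) finite_subset[OF assms(2) finite_verts]
      by (simp add: graph_complement_simps card_Diff_subset)
    fix c assume c: "c \<in> C"
    have nb: "neighbours G c \<subseteq> verts G - {c}" "finite (neighbours G c)"
      using neighbours_subset[OF assms(1)] by auto
    have "insert c (neighbours ?H c) = verts G - neighbours G c"
      using c assms(2) nb by (auto simp: neighbours_def graph_complement_simps)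
    also have "card \<dots> = card (verts G) - card (neighbours G c)"
      using nb by (intro card_Diff_subset) auto
    finally show "card (insert c (neighbours ?H c)) \<le> card (verts G) - card C"
      using degree[OF c] by simp
  qed (use assms clique in \<open>auto simp: graph_complement_simps\<close>)
qed

text \<open>
  The vertices outside the core form a clique of the complement. Conversely, the core satisfies the
  degree condition of the star decomposition, each of its vertices being adjacent to all others.
\<close>

lemma treewidth_complement_core_graph:
  assumes "graph G" "core_graph k G" "k < card (verts G)"
  shows "treewidth (with_proj (graph_complement G)) = card (verts G) - k - 1"
proof -
  interpret graph G by fact
  let ?H = "with_proj (graph_complement G)"
  obtain K where K: "K \<subseteq> verts G" "card K = k" and arcs:
    "arcs_ends G = {(u, v). u \<in> verts G \<and> v \<in> verts G \<and> u \<noteq> v \<and> (u \<in> K \<or> v \<in> K)}"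
    using assms(2) unfolding core_graph_def by blast
  have finK: "finite K" using K(1) finite_verts finite_subset by blast
  have "card (verts G - K) - 1 \<le> treewidth ?H"
    by (rule treewidth_ge_clique[OF graph_complement_graph[OF assms(1)]])
      (auto simp: graph_complement_simps arcs)
  moreover have "treewidth ?H \<le> card (verts G) - card K - 1"
  proof (rule treewidth_complement_le[OF assms(1) K(1)])
    fix c assume c: "c \<in> K"
    then have "neighbours G c = verts G - {c}" using K(1) by (auto simp: neighbours_def arcs)
    then have "card (neighbours G c) = card (verts G) - 1"
      using c K(1) by (simp add: card_Diff_singleton subset_iff)
    then show "card K \<le> card (neighbours G c)" using K(2) assms(3) by simp
  qed (use K(1) in \<open>auto simp: arcs\<close>)
  ultimately show ?thesis using K finK by (simp add: card_Diff_subset)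
qed

theorem theorem4:
  fixes G :: "('a, 'b) pre_digraph" and k n :: nat
  assumes "graph G" and "k_tree k G" and "card (verts G) = n"
  shows "int (treewidth G) + int (treewidth (with_proj (graph_complement G))) =
    (if digraph_iso G (with_proj (Q_graph n k)) then int n - 1 else int n - 2)"
proof -
  have n: "k + 1 \<le> n" using k_tree_card[OF assms(2)] assms(3) by simp
  have iso: "digraph_iso G (with_proj (Q_graph n k)) \<longleftrightarrow> core_graph k G"
    using core_graph_if_iso_Q_graph[OF assms(1), of k n] iso_Q_graph_if_core_graph[OF assms(1), of k]
      assms(3) n by auto
  show ?thesis
  proof (cases "core_graph k G")
    case True
    then show ?thesis
      using treewidth_complement_core_graph[OF assms(1) True] treewidth_k_tree[OF assms(2)] iso n assms(3)
      by simp
  next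
    case False
    then obtain C where C: "C \<subseteq> verts G" "card C = k + 1"
      "\<forall>u\<in>C. \<forall>v\<in>C. u \<noteq> v \<longrightarrow> (u, v) \<in> arcs_ends G"
      "\<forall>c\<in>C. k + 1 \<le> card (neighbours G c)"
      using k_tree_core_or_high_degree_clique[OF assms(2)] by blast
    have "treewidth (with_proj (graph_complement G)) \<le> n - (k + 1) - 1"
      using treewidth_complement_le[OF assms(1) C(1)] C assms(3) by simp
    then have "treewidth (with_proj (graph_complement G)) = n - (k + 1) - 1"
      using treewidth_complement_ge[OF assms(2)] assms(3) by simp
    \<comment> \<open>This makes the natural number \<open>n - (k + 1) - 1\<close> equal to \<open>n - k - 2\<close> without truncation.\<close>
    moreover have "k + 2 \<le> n"
    proof -
      obtain c where c: "c \<in> C" using C(2) by (metis card.empty add_is_0 one_neq_zero ex_in_conv)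
      interpret graph G by fact
      have "k + 1 \<le> card (neighbours G c)" using C(4) c by blast
      also have "\<dots> \<le> card (verts G - {c})"
        using neighbours_subset[OF assms(1)] by (intro card_mono) auto
      also have "\<dots> = n - 1" using C(1) c assms(3) by (simp add: card_Diff_singleton subsetD)
      finally show ?thesis using n by simp
    qed
    ultimately show ?thesis
      using treewidth_k_tree[OF assms(2)] iso False by simp
  qed
qed

end
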